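(* Let $k\ge 1$ and $m\ge 1$ be integers. For any tree $T$ of order $m$, every $k$-connected cograph $G$ with $\delta(G)\ge \left\lfloor \frac{3k}{2}\right\rfloor+m-1$ contains a subtree $T'\cong T$ such that $G-V(T')$ is $k$-connected.
   Context: Graphs are finite, simple and undirected. The order of a graph is its number of vertices; $\delta(G)$ is the minimum degree. Cographs are defined recursively: $K_1$ is a cograph; the disjoint union of cographs is a cograph; the join of cographs is a cograph, where the join $G_1+G_2$ of vertex-disjoint graphs is obtained from their disjoint union by adding all edges between $V(G_1)$ and $V(G_2)$. (Equivalently, cographs are the graphs with no induced path $P_4$ on four vertices.) The connectivity $\kappa(G)$ is the minimum number of vertices whose removal from $G$ results in a disconnected graph or a trivial graph (a graph of order 1); in particular $\kappa(K_1)=0$. $G$ is $k$-connected if $\kappa(G)\ge k$, with the additional convention that $K_1$ is regarded as 1-connected. For a proper subset $S\subsetneq V(G)$, $G-S$ is the graph obtained by deleting all vertices of $S$. A subtree of $G$ is a (not necessarily induced) subgraph that is a tree. *)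

theory Defs
  imports "Graph_Theory.Digraph_Isomorphism"
begin

text \<open>
  A finite simple graph is a \<open>pair_graph\<close>: a finite, loop-free digraph without parallel
  arcs whose arc relation is symmetric, each edge being represented by its two opposite arcs.
  The library predicate \<open>connected\<close> is false for the graph without vertices.
\<close>

text \<open>
  The library predicate \<open>tree\<close> is unsuitable here: in a symmetric digraph every edge yields a
  directed cycle of length 2. The cycles of the underlying undirected graph are the directed
  cycles of length at least 3.
\<close>

definition undirected_tree :: "'a pair_pre_digraph \<Rightarrow> bool" where
  "undirected_tree T \<longleftrightarrow> pair_graph T \<and> connected T \<and>
     \<not> (\<exists>p. pre_digraph.cycle T p \<and> 3 \<le> length p)"

definition disjoint_graphs :: "'a pair_pre_digraph \<Rightarrow> 'a pair_pre_digraph \<Rightarrow> bool" where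
  "disjoint_graphs G H \<longleftrightarrow> pverts G \<inter> pverts H = {}"

definition graph_union :: "'a pair_pre_digraph \<Rightarrow> 'a pair_pre_digraph \<Rightarrow> 'a pair_pre_digraph" where
  "graph_union G H = \<lparr> pverts = pverts G \<union> pverts H, parcs = parcs G \<union> parcs H \<rparr>"

definition graph_join :: "'a pair_pre_digraph \<Rightarrow> 'a pair_pre_digraph \<Rightarrow> 'a pair_pre_digraph" where
  "graph_join G H = \<lparr> pverts = pverts G \<union> pverts H,
     parcs = parcs G \<union> parcs H \<union> pverts G \<times> pverts H \<union> pverts H \<times> pverts G \<rparr>"

inductive cograph :: "'a pair_pre_digraph \<Rightarrow> bool" where
  K1: "cograph \<lparr> pverts = {v}, parcs = {} \<rparr>"
| union: "\<lbrakk> cograph G; cograph H; disjoint_graphs G H \<rbrakk> \<Longrightarrow> cograph (graph_union G H)"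
| join: "\<lbrakk> cograph G; cograph H; disjoint_graphs G H \<rbrakk> \<Longrightarrow> cograph (graph_join G H)"

definition min_degree :: "('a, 'b) pre_digraph \<Rightarrow> nat" where
  "min_degree G = Min (out_degree G ` verts G)"

definition remove_verts :: "('a, 'b) pre_digraph \<Rightarrow> 'a set \<Rightarrow> ('a, 'b) pre_digraph" where
  "remove_verts G S = G \<restriction> (verts G - S)"

text \<open>
  Only proper subsets are removed, so that the remaining graph always has a vertex. A set of
  the required kind exists whenever the graph is finite and has a vertex.
\<close>

definition connectivity :: "('a, 'b) pre_digraph \<Rightarrow> nat" where
  "connectivity G = (LEAST n. \<exists>S. S \<subset> verts G \<and> card S = n \<and>
     (\<not> connected (remove_verts G S) \<or> card (verts (remove_verts G S)) = 1))"

text \<open>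
  The last disjunct is the convention that the graph with one vertex is 1-connected although
  its connectivity is 0. The graph without vertices, for which \<open>connectivity\<close> is
  unspecified, is never k-connected.
\<close>

definition k_connected :: "nat \<Rightarrow> ('a, 'b) pre_digraph \<Rightarrow> bool" where
  "k_connected k G \<longleftrightarrow> verts G \<noteq> {} \<and>
     (k \<le> connectivity G \<or> k = 1 \<and> card (verts G) = 1)"

end

theory Submission
  imports Defs
begin

text \<open>
  The components of the complement of a cograph \<open>G\<close> are pairwise completely joined, and each has
  one vertex or induces a disconnected graph. Hence a k-connected \<open>G\<close> has at least \<open>k\<close> vertices
  outside each of them, and conversely it suffices to leave \<open>k\<close> vertices outside each part of a
  partition into completely joined parts. If every co-component has at least \<open>k + m\<close> vertices
  outside it, any copy of \<open>T\<close>, found greedily, can be removed. Otherwise let \<open>A\<close> be a co-component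
  with fewer vertices outside, and \<open>B\<close> the rest. If \<open>A\<close> is a single vertex, then \<open>k = 1\<close> and \<open>G\<close> has
  \<open>m + 1\<close> vertices. If \<open>A\<close> is disconnected, the degree condition makes \<open>A\<close> so large that
  \<open>\<bar>A\<bar> \<ge> k\<close> and \<open>\<bar>A\<bar> + \<bar>B\<bar> \<ge> 2k + m\<close>, and a copy of \<open>T\<close> leaving \<open>k\<close> vertices in both \<open>A\<close> and \<open>B\<close>
  is placed with the larger colour class \<open>X\<close> of \<open>T\<close>: if \<open>\<bar>B\<bar> - k \<le> \<bar>X\<bar>\<close>, put \<open>\<bar>B\<bar> - k\<close> vertices of
  \<open>X\<close> into \<open>B\<close> and embed the remaining forest greedily in \<open>A\<close>; symmetrically if \<open>\<bar>A\<bar> - k \<le> \<bar>X\<bar>\<close>;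
  otherwise \<open>X\<close> fits into \<open>B\<close> and the other class into \<open>A\<close>.
\<close>

section \<open>Forests and their embeddings\<close>

text \<open>A construction order replaces acyclicity: it can start at any vertex, and no vertex
  closes a cycle when it is added. The colouring and the greedy embedding below are inductions along
  this order and never mention cycles.\<close>

inductive forest_on :: "'b rel \<Rightarrow> 'b set \<Rightarrow> bool" for E where
  empty: "forest_on E {}"
| insert: "\<lbrakk> forest_on E U; v \<notin> U;
    \<And>x y. \<lbrakk> x \<in> U; y \<in> U; (x, v) \<in> E; (y, v) \<in> E \<rbrakk> \<Longrightarrow> x = y \<rbrakk> \<Longrightarrow> forest_on E (insert v U)"

definition indep :: "'b rel \<Rightarrow> 'b set \<Rightarrow> bool" where
  "indep E X \<longleftrightarrow> E \<inter> X \<times> X = {}"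

text \<open>Only edges are preserved, not non-edges, because the subtree sought need not be
  induced.\<close>

definition embedding :: "'b rel \<Rightarrow> 'b set \<Rightarrow> 'a rel \<Rightarrow> 'a set \<Rightarrow> ('b \<Rightarrow> 'a) \<Rightarrow> bool" where
  "embedding E U D W f \<longleftrightarrow> inj_on f U \<and> f ` U \<subseteq> W \<and>
     (\<forall>u\<in>U. \<forall>v\<in>U. (u, v) \<in> E \<longrightarrow> (f u, f v) \<in> D)"

lemma forest_on_subset:
  assumes "forest_on E U" and "W \<subseteq> U"
  shows "forest_on E W"
  using assms
proof (induction arbitrary: W)
  case empty
  then show ?case by (simp add: forest_on.empty)
next
  case (insert U v)
  have f: "forest_on E (W - {v})"
    by (rule insert.IH) (use insert.prems in auto)
  show ?case
  proof (cases "v \<in> W")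
    case True
    have "forest_on E (insert v (W - {v}))"
    proof (rule forest_on.insert[OF f])
      fix x y
      assume "x \<in> W - {v}" "y \<in> W - {v}" "(x, v) \<in> E" "(y, v) \<in> E"
      then show "x = y" using insert.hyps(3) insert.prems by blast
    qed simp
    then show ?thesis using True by (simp add: insert_absorb)
  next
    case False
    then show ?thesis using f by simp
  qed
qed

text \<open>The new vertex has at most one earlier neighbour, so it can join the class that does not
  contain this neighbour.\<close>

lemma forest_on_two_colouring:
  assumes "forest_on E U" and "sym E" and "irrefl E"
  obtains X where "X \<subseteq> U" and "indep E X" and "indep E (U - X)"
  using assms(1)
proof (induction arbitrary: thesis)
  case empty
  then show ?case by (simp add: indep_def)
next
  case (insert U v)
  obtain X where X: "X \<subseteq> U" "indep E X" "indep E (U - X)"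
    by (rule insert.IH)
  have irr: "(v, v) \<notin> E" using assms(3) by (auto simp: irrefl_def)
  show ?case
  proof (cases "\<exists>x\<in>X. (x, v) \<in> E")
    case True
    then obtain x where x: "x \<in> X" "(x, v) \<in> E" by blast
    have "indep E (insert v (U - X))"
      unfolding indep_def
    proof (intro equals0I, clarify)
      fix a b
      assume ab: "(a, b) \<in> E" "a \<in> insert v (U - X)" "b \<in> insert v (U - X)"
      have no: "(y, v) \<notin> E" if "y \<in> U - X" for y
        using insert.hyps(3)[of x y] x X(1) that by blast
      show False
        using ab no irr X(3) assms(2) by (auto simp: indep_def dest: symD)
    qed
    moreover have "insert v U - X = insert v (U - X)" using X(1) insert.hyps(2) by blast
    ultimately show ?thesis using X insert.prems[of X] by auto
  next
    case False
    have "indep E (insert v X)"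
      unfolding indep_def
    proof (intro equals0I, clarify)
      fix a b
      assume "(a, b) \<in> E" "a \<in> insert v X" "b \<in> insert v X"
      then show False
        using False irr X(2) assms(2) by (auto simp: indep_def dest: symD)
    qed
    moreover have "insert v U - insert v X = U - X" using insert.hyps(2) by blast
    ultimately show ?thesis using X insert.prems[of "insert v X"] by auto
  qed
qed

lemma forest_on_finite: "forest_on E U \<Longrightarrow> finite U"
  by (induction rule: forest_on.induct) auto

text \<open>Greedy placement along the construction order. A vertex with an earlier neighbour needs
  a free vertex adjacent to the image of that neighbour, which the degree bound inside
  \<open>A\<close> supplies; any other vertex only needs a free place in \<open>A\<close>.\<close>

lemma forest_on_embedding:
  assumes "forest_on E U" and "sym E" and "irrefl E" and "sym D" and "irrefl D"
    and "finite A" and "card U \<le> card A"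
    and "\<And>a. a \<in> A \<Longrightarrow> card U \<le> card (D `` {a} \<inter> A) + 1"
  shows "\<exists>f. embedding E U D A f"
  using assms(1,7,8)
proof (induction)
  case empty
  then show ?case by (simp add: embedding_def)
next
  case (insert U v)
  have finU: "finite U" using insert.hyps(1) by (rule forest_on_finite)
  have cardU: "card (insert v U) = card U + 1" using finU insert.hyps(2) by simp
  have "\<exists>f. embedding E U D A f"
    by (rule insert.IH) (use insert.prems cardU in fastforce)+
  then obtain f where f: "inj_on f U" "f ` U \<subseteq> A"
    "\<And>x y. \<lbrakk> x \<in> U; y \<in> U; (x, y) \<in> E \<rbrakk> \<Longrightarrow> (f x, f y) \<in> D"
    by (auto simp: embedding_def)
  have irr: "(v, v) \<notin> E" using assms(3) by (auto simp: irrefl_def)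
  have "\<exists>w. w \<in> A - f ` U \<and> (\<forall>x\<in>U. (x, v) \<in> E \<longrightarrow> (f x, w) \<in> D)"
  proof (cases "\<exists>x\<in>U. (x, v) \<in> E")
    case True
    then obtain x where x: "x \<in> U" "(x, v) \<in> E" by blast
    \<comment> \<open>\<open>f x\<close> is not its own neighbour, so at most
      \<open>card U - 1\<close> used vertices compete for its neighbours in \<open>A\<close>, of
      which there are at least \<open>card U\<close>.\<close>
    have "card (f ` U - {f x}) < card U"
      using x(1) finU by (metis card_Diff1_less card_image f(1) finite_imageI imageI)
    also have "card U \<le> card (D `` {f x} \<inter> A)"
      using insert.prems(2)[of "f x"] f(2) x(1) cardU by auto
    finally have "\<not> D `` {f x} \<inter> A \<subseteq> f ` U - {f x}"
      using finU by (meson card_mono finite_Diff finite_imageI not_less)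
    then obtain w where "w \<in> A" "(f x, w) \<in> D" "w \<notin> f ` U - {f x}" by auto
    moreover have "w \<noteq> f x" using \<open>(f x, w) \<in> D\<close> assms(5) by (auto simp: irrefl_def)
    ultimately show ?thesis using insert.hyps(3)[OF _ x(1) _ x(2)] by blast
  next
    case False
    have "card (f ` U) < card A" using insert.prems(1) cardU card_image[OF f(1)] by simp
    then have "\<not> A \<subseteq> f ` U" using finU by (meson card_mono finite_imageI not_less)
    then show ?thesis using False by blast
  qed
  then obtain w where w: "w \<in> A" "w \<notin> f ` U"
    and wD: "\<And>x. \<lbrakk> x \<in> U; (x, v) \<in> E \<rbrakk> \<Longrightarrow> (f x, w) \<in> D"
    by blast
  have wD': "(w, f x) \<in> D" if "x \<in> U" "(v, x) \<in> E" for x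
    using wD[of x] that assms(2,4) by (blast dest: symD)
  have "embedding E (insert v U) D A (f(v := w))"
    unfolding embedding_def
  proof (intro conjI ballI impI)
    show "inj_on (f(v := w)) (insert v U)"
      using f(1) w(2) insert.hyps(2) by (auto simp: inj_on_def)
    show "(f(v := w)) ` insert v U \<subseteq> A"
      using f(2) w(1) by auto
  next
    fix x y
    assume "x \<in> insert v U" "y \<in> insert v U" "(x, y) \<in> E"
    then show "((f(v := w)) x, (f(v := w)) y) \<in> D"
      using f(3) wD wD' irr insert.hyps(2) by auto
  qed
  then show ?case by blast
qed

section \<open>Embeddings into two completely joined sets\<close>

lemma indep_embedding:
  assumes "indep E X" and "finite X" and "finite B" and "card X \<le> card B"
  shows "\<exists>f. embedding E X D B f"
proof -
  obtain f where "f ` X \<subseteq> B" "inj_on f X"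
    using card_le_inj[OF assms(2-4)] by blast
  then show ?thesis using assms(1) by (auto simp: embedding_def indep_def)
qed

text \<open>Edges between \<open>X\<close> and \<open>U - X\<close> are preserved by any choice of
  images, since \<open>A\<close> and \<open>B\<close> are completely joined. Only the two
  restrictions have to be embeddings, and as \<open>A\<close> and \<open>B\<close> are disjoint the
  two maps can be pasted together.\<close>

lemma embedding_join:
  assumes "finite U" and "X \<subseteq> U" and "sym D" and "A \<inter> B = {}" and "A \<times> B \<subseteq> D"
    and "finite A" and "finite B"
    and "\<exists>h. embedding E X D B h" and "\<exists>g. embedding E (U - X) D A g"
  shows "\<exists>f. embedding E U D (A \<union> B) f \<and>
    card (A - f ` U) = card A - card (U - X) \<and> card (B - f ` U) = card B - card X"
proof -
  obtain h where h: "embedding E X D B h" using assms(8) by blast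
  obtain g where g: "embedding E (U - X) D A g" using assms(9) by blast
  define f where "f u = (if u \<in> X then h u else g u)" for u
  have fX: "f ` X = h ` X" and fU: "f ` (U - X) = g ` (U - X)" by (auto simp: f_def)
  have hB: "h ` X \<subseteq> B" and hi: "inj_on h X" using h by (auto simp: embedding_def)
  have gA: "g ` (U - X) \<subseteq> A" and gi: "inj_on g (U - X)" using g by (auto simp: embedding_def)
  have img: "f ` U = h ` X \<union> g ` (U - X)" using fX fU assms(2) by blast
  have BA: "(b, a) \<in> D" if "a \<in> A" "b \<in> B" for a b
    using assms(3,5) that by (blast dest: symD)
  have "embedding E U D (A \<union> B) f"
    unfolding embedding_def
  proof (intro conjI ballI impI)
    show "inj_on f U"
    proof (rule inj_onI)
      fix x y
      assume xy: "x \<in> U" "y \<in> U" "f x = f y"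
      have "f z \<in> A \<longleftrightarrow> z \<notin> X" if "z \<in> U" for z
        using that hB gA assms(4) by (auto simp: f_def)
      then have iff: "x \<in> X \<longleftrightarrow> y \<in> X" using xy by metis
      show "x = y"
      proof (cases "x \<in> X")
        case True
        then show ?thesis using xy iff inj_onD[OF hi, of x y] by (simp add: f_def)
      next
        case False
        then show ?thesis using xy iff inj_onD[OF gi, of x y] by (simp add: f_def)
      qed
    qed
    show "f ` U \<subseteq> A \<union> B" using img hB gA by blast
  next
    fix x y
    assume xy: "x \<in> U" "y \<in> U" "(x, y) \<in> E"
    have f_in: "if z \<in> X then f z \<in> B else f z \<in> A" if "z \<in> U" for z
      using that hB gA by (auto simp: f_def)
    consider "x \<in> X" "y \<in> X" | "x \<notin> X" "y \<notin> X" | "x \<in> X \<longleftrightarrow> y \<notin> X" by blast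
    then show "(f x, f y) \<in> D"
    proof cases
      case 1
      then show ?thesis using h xy(3) by (simp add: f_def embedding_def)
    next
      case 2
      then show ?thesis using g xy by (simp add: f_def embedding_def)
    next
      case 3
      then show ?thesis
        using f_in[OF xy(1)] f_in[OF xy(2)] BA assms(5) by (cases "x \<in> X") auto
    qed
  qed
  moreover have "A - f ` U = A - g ` (U - X)" "B - f ` U = B - h ` X"
    unfolding img using hB gA assms(4) by blast+
  moreover have "card (A - g ` (U - X)) = card A - card (U - X)"
    using gA gi assms(6) by (simp add: card_Diff_subset finite_subset card_image)
  moreover have "card (B - h ` X) = card B - card X"
    using hB hi assms(7) by (simp add: card_Diff_subset finite_subset card_image)
  ultimately show ?thesis by metis
qed

text \<open>A set \<open>Y\<close> of \<open>card B - k\<close> vertices of \<open>X\<close> fills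
  \<open>B\<close> up to exactly \<open>k\<close> free places. A vertex of \<open>A\<close> has at
  most \<open>card B\<close> neighbours in \<open>B\<close>, so its degree inside \<open>A\<close>
  is at least \<open>k + card U - 1 - card B = card (U - Y) - 1\<close>, which is what the greedy
  embedding of \<open>U - Y\<close> requires.\<close>

lemma embedding_join_unbalanced:
  assumes U: "forest_on E U" "sym E" "irrefl E" and D: "sym D" "irrefl D"
    and AB: "finite A" "finite B" "A \<inter> B = {}" "A \<times> B \<subseteq> D"
    and deg: "\<And>a. a \<in> A \<Longrightarrow> k + card U \<le> card (D `` {a} \<inter> (A \<union> B)) + 1"
    and card: "k \<le> card B" "2 * k + card U \<le> card A + card B"
    and X: "X \<subseteq> U" "indep E X" "card B - k \<le> card X"
  shows "\<exists>f. embedding E U D (A \<union> B) f \<and> k \<le> card (A - f ` U) \<and> k \<le> card (B - f ` U)"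
proof -
  have finU: "finite U" using U(1) by (rule forest_on_finite)
  obtain Y where Y: "Y \<subseteq> X" "card Y = card B - k"
    using X(3) by (meson obtain_subset_with_card_n)
  have finY: "finite Y" using Y(1) X(1) finite_subset[OF _ finU] by (meson subset_trans)
  have YU: "Y \<subseteq> U" using Y(1) X(1) by (rule subset_trans)
  have indY: "indep E Y" using X(2) Y(1) by (auto simp: indep_def)
  have cU: "card (U - Y) = card U - (card B - k)" "card B - k \<le> card U"
    using card_Diff_subset[OF finY YU] Y(2) card_mono[OF finU YU] by auto
  have "\<exists>g. embedding E (U - Y) D A g"
  proof (rule forest_on_embedding[OF _ U(2,3) D AB(1)])
    show "forest_on E (U - Y)" using forest_on_subset[OF U(1)] by blast
    show "card (U - Y) \<le> card A" using cU card by linarith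
  next
    fix a
    assume a: "a \<in> A"
    have "D `` {a} \<inter> (A \<union> B) \<subseteq> (D `` {a} \<inter> A) \<union> B" by blast
    then have "card (D `` {a} \<inter> (A \<union> B)) \<le> card ((D `` {a} \<inter> A) \<union> B)"
      using AB by (intro card_mono) auto
    also have "\<dots> \<le> card (D `` {a} \<inter> A) + card B" by (rule card_Un_le)
    finally show "card (U - Y) \<le> card (D `` {a} \<inter> A) + 1"
      using deg[OF a] cU card(1) by linarith
  qed
  moreover have "\<exists>h. embedding E Y D B h"
    using indY finY AB(2) Y(2) by (intro indep_embedding) auto
  ultimately obtain f where f: "embedding E U D (A \<union> B) f"
    "card (A - f ` U) = card A - card (U - Y)" "card (B - f ` U) = card B - card Y"
    using embedding_join[OF finU YU D(1) AB(3,4,1,2)] by blast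
  then have "k \<le> card (A - f ` U)" "k \<le> card (B - f ` U)"
    using cU card Y(2) by linarith+
  then show ?thesis using f by blast
qed

lemma embedding_join_forest:
  assumes U: "forest_on E U" "sym E" "irrefl E" and D: "sym D" "irrefl D"
    and AB: "finite A" "finite B" "A \<inter> B = {}" "A \<times> B \<subseteq> D"
    and deg: "\<And>a. a \<in> A \<union> B \<Longrightarrow> k + card U \<le> card (D `` {a} \<inter> (A \<union> B)) + 1"
    and card: "k \<le> card A" "k \<le> card B" "2 * k + card U \<le> card A + card B"
  shows "\<exists>f. embedding E U D (A \<union> B) f \<and> k \<le> card (A - f ` U) \<and> k \<le> card (B - f ` U)"
proof -
  have finU: "finite U" using U(1) by (rule forest_on_finite)
  have BA: "B \<inter> A = {}" "B \<times> A \<subseteq> D" using AB(3,4) D(1) by (auto dest: symD)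
  obtain X where X: "X \<subseteq> U" "indep E X" "indep E (U - X)" "card (U - X) \<le> card X"
  proof -
    obtain X where X: "X \<subseteq> U" "indep E X" "indep E (U - X)"
      by (rule forest_on_two_colouring[OF U])
    have "U - (U - X) = X" using X(1) by blast
    \<comment> \<open>The two colour classes are interchangeable, so the larger one may be called
      \<open>X\<close>.\<close>
    then show thesis
      using that[of X] that[of "U - X"] X by (metis Diff_subset nle_le)
  qed
  have finX: "finite X" using X(1) finU finite_subset by blast
  consider "card B - k \<le> card X" | "card A - k \<le> card X"
    | "card X < card B - k" "card X < card A - k" by linarith
  then show ?thesis
  proof cases
    case 1
    show ?thesis
      by (rule embedding_join_unbalanced[OF U D AB _ card(2,3) X(1,2) 1]) (use deg in auto)
  next
    case 2
    have "\<exists>f. embedding E U D (B \<union> A) f \<and> k \<le> card (B - f ` U) \<and> k \<le> card (A - f ` U)"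
      by (rule embedding_join_unbalanced[OF U D AB(2,1) BA _ card(1) _ X(1,2) 2])
        (use deg card in \<open>auto simp: Un_commute\<close>)
    then show ?thesis by (auto simp: Un_commute)
  next
    case 3
    \<comment> \<open>Both classes fit with \<open>k\<close> places to spare, since
      \<open>card (U - X) \<le> card X < card A - k\<close>.\<close>
    have "\<exists>h. embedding E X D B h"
      using X(2) finX AB(2) 3 by (intro indep_embedding) auto
    moreover have "\<exists>g. embedding E (U - X) D A g"
      using X(3,4) finU AB(1) 3 by (intro indep_embedding) auto
    ultimately obtain f where f: "embedding E U D (A \<union> B) f"
      "card (A - f ` U) = card A - card (U - X)" "card (B - f ` U) = card B - card X"
      using embedding_join[OF finU X(1) D(1) AB(3,4,1,2)] by blast
    then have "k \<le> card (A - f ` U)" "k \<le> card (B - f ` U)"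
      using 3 X(4) by linarith+
    then show ?thesis using f by blast
  qed
qed

section \<open>Trees\<close>

text \<open>The construction order comes from growing a connected vertex set by one vertex at a
  time. If the new vertex had two neighbours in the set, a path between them inside the set would
  close to a cycle.\<close>

lemma undirected_tree_forest_on:
  assumes "undirected_tree T"
  shows "forest_on (parcs T) (pverts T)"
proof -
  interpret T: pair_graph T using assms by (simp add: undirected_tree_def)
  have conn: "connected (with_proj T)" using assms by (simp add: undirected_tree_def)
  have acyc: "\<not> (T.cycle p \<and> 3 \<le> length p)" for p
    using assms by (auto simp: undirected_tree_def)
  have symT: "(y, x) \<in> parcs T" if "(x, y) \<in> parcs T" for x y
    using that by (rule T.arcs_symmetric)
  \<comment> \<open>The paths are required to stay inside \<open>C\<close>, so that they avoid every
    vertex added later.\<close>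
  define P where "P C \<longleftrightarrow> C \<subseteq> pverts T \<and> C \<noteq> {} \<and> forest_on (parcs T) C \<and>
    (\<forall>x\<in>C. \<forall>y\<in>C. \<exists>p. T.apath x p y \<and> set (pawalk_verts x p) \<subseteq> C)" for C
  have grow: "\<exists>v\<in>pverts T - C. P (insert v C)" if PC: "P C" and ne: "C \<noteq> pverts T" for C
  proof -
    obtain x0 y0 where x0: "x0 \<in> C" and y0: "y0 \<in> pverts T - C"
      using PC ne by (auto simp: P_def)
    have "(x0, y0) \<in> rtrancl_on (pverts T) (symcl (parcs T))"
      using conn x0 y0 PC unfolding connected_conv P_def by auto
    \<comment> \<open>A walk from \<open>C\<close> to a vertex outside \<open>C\<close> must leave
      \<open>C\<close> along some edge.\<close>
    from this y0 have "\<exists>x v. x \<in> C \<and> v \<in> pverts T - C \<and> (x, v) \<in> parcs T"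
    proof (induction rule: rtrancl_on_induct)
      case base
      then show ?case using x0 by blast
    next
      case (step x y)
      then show ?case
        by (cases "x \<in> C") (auto simp: symcl_def dest: symT)
    qed
    then obtain x v where x: "x \<in> C" and v: "v \<in> pverts T - C" and xv: "(x, v) \<in> parcs T"
      by blast
    have uniq: "y = z" if y: "y \<in> C" "(y, v) \<in> parcs T" and z: "z \<in> C" "(z, v) \<in> parcs T" for y z
    proof (rule ccontr)
      assume "y \<noteq> z"
      obtain p where p: "T.apath y p z" "set (pawalk_verts y p) \<subseteq> C"
        using PC y z unfolding P_def by blast
      \<comment> \<open>A nonempty \<open>p\<close> gives the closed walk through \<open>v\<close>
        at least three arcs, which separates it from the 2-cycles formed by opposite arcs.\<close>
      have pne: "p \<noteq> []" using p(1) \<open>y \<noteq> z\<close> by (auto simp: T.apath_Nil_iff)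
      let ?c = "(v, y) # p @ [(z, v)]"
      have w: "T.awalk v ?c v"
        using p(1) y z v symT by (auto simp: T.apath_def T.awalk_simps)
      have "pawalk_verts y (p @ [(z, v)]) = pawalk_verts y p @ [v]"
        using p(1) by (subst T.awalk_verts_append[of _ _ _ v])
          (use p(1) z v in \<open>auto simp: T.apath_def T.awalk_simps\<close>)
      then have "distinct (tl (pawalk_verts v ?c))"
        using p v by (auto simp: T.apath_def)
      then have "T.cycle ?c" using w unfolding T.cycle_def by auto
      moreover have "3 \<le> length ?c" using pne by (cases p) auto
      ultimately show False using acyc by blast
    qed
    have "forest_on (parcs T) (insert v C)"
      by (rule forest_on.insert) (use PC v uniq in \<open>auto simp: P_def\<close>)
    moreover have from_v: "\<exists>p. T.apath v p y \<and> set (pawalk_verts v p) \<subseteq> insert v C" if y: "y \<in> C" for y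
    proof -
      obtain p where p: "T.apath x p y" "set (pawalk_verts x p) \<subseteq> C"
        using PC x y unfolding P_def by blast
      have "T.apath v ((v, x) # p) y"
        using p v xv symT by (auto simp: T.apath_Cons_iff)
      then show ?thesis using p(2) by (intro exI[of _ "(v, x) # p"]) auto
    qed
    moreover have "\<exists>p. T.apath y p v \<and> set (pawalk_verts y p) \<subseteq> insert v C" if y: "y \<in> C" for y
    proof -
      obtain p where p: "T.apath v p y" "set (pawalk_verts v p) \<subseteq> insert v C"
        using from_v[OF y] by blast
      then show ?thesis
        using T.awalk_verts_rev_path[of v p y]
        by (intro exI[of _ "rev_path p"]) (auto simp: T.apath_def)
    qed
    moreover have "T.apath v [] v" using v by (simp add: T.apath_Nil_iff)
    then have "\<exists>p. T.apath v p v \<and> set (pawalk_verts v p) \<subseteq> insert v C"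
      by (intro exI[of _ "[]"]) auto
    moreover have "\<exists>p. T.apath y p z \<and> set (pawalk_verts y p) \<subseteq> insert v C"
      if "y \<in> C" "z \<in> C" for y z
      using PC that unfolding P_def by blast
    ultimately have "P (insert v C)" using PC v by (auto simp: P_def)
    then show ?thesis using v by blast
  qed
  obtain r where r: "r \<in> pverts T" using conn unfolding connected_conv by auto
  have "P {r}"
    unfolding P_def using r forest_on.insert[OF forest_on.empty, of r "parcs T"]
    by (auto simp: T.apath_Nil_iff intro!: exI[of _ "[]"])
  \<comment> \<open>Growth reaches every size up to \<open>card (pverts T)\<close>, and at that size
    the set is all of \<open>pverts T\<close>.\<close>
  have ex: "\<exists>C. P C \<and> card C = n" if "1 \<le> n" "n \<le> card (pverts T)" for n
    using that
  proof (induction n rule: dec_induct)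
    case base
    then show ?case using \<open>P {r}\<close> by (intro exI[of _ "{r}"]) auto
  next
    case (step n)
    then obtain C where C: "P C" "card C = n" by auto
    then have "C \<noteq> pverts T" using step.prems by auto
    then obtain v where "v \<in> pverts T - C" "P (insert v C)" using grow C(1) by blast
    moreover have "finite C" using C(1) finite_subset[OF _ T.pair_finite_verts] unfolding P_def by blast
    ultimately show ?case using C(2) by (intro exI[of _ "insert v C"]) auto
  qed
  have fin: "finite (pverts T)" using T.finite_verts by simp
  have "1 \<le> card (pverts T)" using r fin by (simp add: Suc_le_eq card_gt_0_iff) blast
  then obtain C where "P C" "card C = card (pverts T)" using ex by blast
  then show ?thesis using card_subset_eq[OF fin] unfolding P_def by metis
qed

section \<open>Transport of trees along embeddings\<close>

lemma (in wf_digraph) cycle_app_iso: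
  assumes "cycle p" and "digraph_isomorphism hom"
  shows "pre_digraph.cycle (app_iso hom G) (map (iso_arcs hom) p)"
proof -
  obtain u where u: "awalk u p u" "distinct (tl (awalk_verts u p))" "p \<noteq> []"
    using assms(1) by (auto simp: cycle_def)
  have "set (tl (awalk_verts u p)) \<subseteq> verts G"
    using u(1) by (meson awalkE awalk_verts_non_Nil list.set_sel(2) subset_iff)
  then have "distinct (map (iso_verts hom) (tl (awalk_verts u p)))"
    using u(2) digraph_isomorphism_inj_on_verts[OF assms(2)]
    by (simp add: distinct_map inj_on_subset)
  then show ?thesis
    unfolding pre_digraph.cycle_def
    using awalk_app_isoI[OF u(1) assms(2)] awalk_verts_app_iso_eq[OF assms(2) u(1)] u(3)
    by (intro exI[of _ "iso_verts hom u"]) (auto simp: map_tl)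
qed

text \<open>\<open>T'\<close> carries only the images of the arcs of \<open>T\<close>, not all arcs
  of \<open>G\<close> between its vertices. This makes it isomorphic to \<open>T\<close>, so
  connectedness carries over and a long cycle in \<open>T'\<close> can be pulled back to
  \<open>T\<close>.\<close>

lemma undirected_tree_image:
  assumes "undirected_tree T" and "pair_graph G"
    and "embedding (parcs T) (pverts T) (parcs G) (pverts G) f"
  shows "\<exists>T'. undirected_tree T' \<and> subgraph (with_proj T') (with_proj G) \<and>
    digraph_iso (with_proj T') (with_proj T) \<and> pverts T' = f ` pverts T"
proof -
  interpret T: pair_graph T using assms(1) by (simp add: undirected_tree_def)
  interpret G: pair_graph G by fact
  have inj: "inj_on f (pverts T)" and fG: "f ` pverts T \<subseteq> pverts G"
    and fD: "\<And>u v. (u, v) \<in> parcs T \<Longrightarrow> (f u, f v) \<in> parcs G"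
    using assms(3) T.in_arcsD1 T.in_arcsD2 by (auto simp: embedding_def)
  define T' where "T' = \<lparr> pverts = f ` pverts T, parcs = map_prod f f ` parcs T \<rparr>"
  define hom where "hom = \<lparr> iso_verts = f, iso_arcs = map_prod f f, iso_head = snd, iso_tail = fst \<rparr>"
  have T'_eq: "with_proj T' = app_iso hom (with_proj T)"
    by (simp add: T'_def hom_def with_proj_def app_iso_def)
  have "inj_on (map_prod f f) (parcs T)"
    by (rule inj_on_subset[OF map_prod_inj_on[OF inj inj]])
      (auto dest: T.in_arcsD1 T.in_arcsD2)
  then have iso: "T.digraph_isomorphism hom"
    unfolding T.digraph_isomorphism_def using inj T.wf_digraph_axioms
    by (auto simp: hom_def)
  have pg: "pair_graph T'"
  proof
    show "fst e \<in> pverts T'" "snd e \<in> pverts T'" if "e \<in> parcs T'" for e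
      using that T.in_arcsD1 T.in_arcsD2 by (auto simp: T'_def)
    show "finite (pverts T')" "finite (parcs T')"
      using T.finite_verts T.finite_arcs by (auto simp: T'_def)
    show "fst e \<noteq> snd e" if eT': "e \<in> parcs T'" for e
    proof -
      obtain u v where e: "(u, v) \<in> parcs T" "e = (f u, f v)" using eT' by (auto simp: T'_def)
      then have "(f u, f v) \<in> parcs G" using fD by blast
      then show ?thesis using e(2) G.no_loops' by auto
    qed
    show "symmetric (with_proj T')"
      unfolding symmetric_def sym_def using T.arcs_symmetric by (force simp: T'_def)
  qed
  then interpret T': pair_graph T' .
  have "\<not> (T'.cycle p \<and> 3 \<le> length p)" for p
  proof
    assume p: "T'.cycle p \<and> 3 \<le> length p"
    have "pre_digraph.digraph_isomorphism (with_proj T') (T.inv_iso hom)"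
      unfolding T'_eq using T.digraph_isomorphism_invI[OF iso] .
    then have "pre_digraph.cycle (app_iso (T.inv_iso hom) (with_proj T')) (map (iso_arcs (T.inv_iso hom)) p)"
      using T'.cycle_app_iso p by blast
    then have "T.cycle (map (iso_arcs (T.inv_iso hom)) p)"
      unfolding T'_eq using iso by simp
    then show False using assms(1) p by (auto simp: undirected_tree_def)
  qed
  moreover have "connected (with_proj T')"
    unfolding T'_eq by (rule T.connectedI_app_iso[OF _ iso]) (use assms(1) in \<open>simp add: undirected_tree_def\<close>)
  ultimately have "undirected_tree T'" using pg by (auto simp: undirected_tree_def)
  moreover have "subgraph (with_proj T') (with_proj G)"
    unfolding subgraph_def using fG fD G.wf_digraph_axioms T'.wf_digraph_axioms
    by (auto simp: T'_def)
  moreover have "digraph_iso (with_proj T') (with_proj T)"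
    by (rule digraph_iso_swap[OF T.wf_digraph_axioms]) (use iso T'_eq in \<open>auto simp: digraph_iso_def\<close>)
  ultimately show ?thesis by (auto simp: T'_def)
qed

section \<open>Connectivity of cographs\<close>

text \<open>After deleting fewer than \<open>k\<close> further vertices, every remaining
  \<open>u\<close> in its part \<open>A\<close> still has some remaining \<open>w\<close> outside
  \<open>A\<close>. Vertices outside \<open>A\<close> are adjacent to \<open>u\<close>, and those
  inside \<open>A\<close> are reached through \<open>w\<close>. Thus the rest is connected, and
  \<open>w\<close> shows that it is not trivial.\<close>

lemma k_connected_remove_vertsI:
  fixes G :: "'a pair_pre_digraph"
  assumes "pair_graph G" and "1 \<le> k" and "pverts G - S \<noteq> {}"
    and parts: "\<And>a. a \<in> pverts G - S \<Longrightarrow> \<exists>A. a \<in> A \<and> k \<le> card (pverts G - S - A) \<and>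
      (\<forall>x\<in>A \<inter> pverts G. \<forall>y\<in>pverts G - A. (x, y) \<in> parcs G)"
  shows "k_connected k (remove_verts G S)"
proof -
  interpret G: pair_graph G by fact
  let ?H = "remove_verts (with_proj G) S"
  let ?W = "pverts G - S"
  let ?P = "\<lambda>n. \<exists>X. X \<subset> verts ?H \<and> card X = n \<and>
     (\<not> connected (remove_verts ?H X) \<or> card (verts (remove_verts ?H X)) = 1)"
  have vH: "verts ?H = ?W" by (simp add: remove_verts_def)
  have finW: "finite ?W" using G.finite_verts by simp
  obtain a where a: "a \<in> ?W" using assms(3) by blast
  \<comment> \<open>Deleting all vertices but \<open>a\<close> leaves a trivial graph, so the least
    number in \<open>connectivity\<close> exists.\<close>
  have "?P (card (?W - {a}))"
    by (rule exI[of _ "?W - {a}"]) (use a in \<open>auto simp: remove_verts_def double_diff\<close>)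
  moreover have "k \<le> n" if "?P n" for n
  proof (rule ccontr)
    assume "\<not> k \<le> n"
    obtain X where X: "X \<subset> ?W" "card X = n"
      and bad: "\<not> connected (remove_verts ?H X) \<or> card (verts (remove_verts ?H X)) = 1"
      using \<open>?P n\<close> unfolding vH by blast
    let ?K = "remove_verts ?H X"
    have vK: "verts ?K = ?W - X" by (simp add: remove_verts_def)
    have aK: "(x, y) \<in> arcs_ends ?K" if "x \<in> ?W - X" "y \<in> ?W - X" "(x, y) \<in> parcs G" for x y
      using that by (auto simp: remove_verts_def arcs_ends_conv image_iff intro!: bexI[of _ "(x, y)"])
    have finX: "finite X" using X(1) finW finite_subset by blast
    have nb: "\<exists>A w. x \<in> A \<and> w \<in> ?W - X - A \<and> (\<forall>x\<in>A \<inter> pverts G. \<forall>y\<in>pverts G - A. (x, y) \<in> parcs G)"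
      if "x \<in> ?W - X" for x
    proof -
      have "x \<in> ?W" using that by blast
      from parts[OF this] obtain A where A: "x \<in> A" "k \<le> card (?W - A)"
        "\<forall>x\<in>A \<inter> pverts G. \<forall>y\<in>pverts G - A. (x, y) \<in> parcs G" by blast
      have "\<not> ?W - A \<subseteq> X"
      proof
        assume "?W - A \<subseteq> X"
        then have "card (?W - A) \<le> n" using card_mono[OF finX] X(2) by blast
        then show False using A(2) \<open>\<not> k \<le> n\<close> by linarith
      qed
      then show ?thesis using A(1,3) by blast
    qed
    have wne: "?W - X \<noteq> {}" using X(1) by blast
    have edge: "(x, y) \<in> rtrancl_on (?W - X) (symcl (arcs_ends ?K))"
      if "x \<in> ?W - X" "y \<in> ?W - X" "(x, y) \<in> parcs G" for x y
      by (rule rtrancl_on_into_rtrancl_on[OF rtrancl_on_refl])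
        (use aK[OF that] that in \<open>auto simp: symcl_def\<close>)
    have reach: "(u, v) \<in> rtrancl_on (?W - X) (symcl (arcs_ends ?K))"
      if u: "u \<in> ?W - X" and v: "v \<in> ?W - X" for u v
    proof -
      obtain A w where A: "u \<in> A" "w \<in> ?W - X - A"
        "\<And>x y. \<lbrakk> x \<in> A; x \<in> pverts G; y \<in> pverts G; y \<notin> A \<rbrakk> \<Longrightarrow> (x, y) \<in> parcs G"
        using nb[OF u] by blast
      show ?thesis
      proof (cases "v \<in> A")
        case True
        have "(u, w) \<in> parcs G" "(w, v) \<in> parcs G"
          using A u v True by (auto intro: G.arcs_symmetric)
        then show ?thesis
          using edge[of u w] edge[of w v] u v A(2) by (auto intro: rtrancl_on_trans)
      next
        case False
        then show ?thesis using edge[OF u v] A u v by auto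
      qed
    qed
    have "connected ?K"
      unfolding connected_conv vK using reach wne by blast
    moreover have "card (verts ?K) \<noteq> 1"
    proof
      assume "card (verts ?K) = 1"
      then obtain x where x: "?W - X = {x}" unfolding vK by (auto simp: card_1_singleton_iff)
      then obtain A w where w: "x \<in> A" "w \<in> ?W - X - A" using nb[of x] by auto
      then have "w \<in> {x}" unfolding x[symmetric] by blast
      then show False using w by blast
    qed
    ultimately show False using bad by blast
  qed
  ultimately have "k \<le> (LEAST n. ?P n)" by (rule LeastI2)
  then show ?thesis using a unfolding k_connected_def connectivity_def vH by auto
qed

text \<open>The last hypothesis excludes the convention for \<open>K_1\<close>, which is 1-connected
  although its connectivity is 0.\<close>

lemma k_connected_card_le:
  fixes G :: "('a, 'b) pre_digraph"
  assumes "k_connected k G" and "S \<subset> verts G"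
    and "\<not> connected (remove_verts G S) \<or> card (verts (remove_verts G S)) = 1"
    and "card (verts G) \<noteq> 1"
  shows "k \<le> card S"
proof -
  have "connectivity G \<le> card S"
    unfolding connectivity_def by (rule Least_le) (use assms(2,3) in blast)
  then show ?thesis using assms(1,4) by (auto simp: k_connected_def)
qed

text \<open>Disconnectedness of the graph induced on \<open>A\<close>, given by an explicit
  bipartition so that the vertices on each side can be counted separately.\<close>

definition separated :: "'a rel \<Rightarrow> 'a set \<Rightarrow> bool" where
  "separated E A \<longleftrightarrow> (\<exists>C D. C \<noteq> {} \<and> D \<noteq> {} \<and> C \<inter> D = {} \<and> A = C \<union> D \<and>
     E \<inter> (C \<times> D \<union> D \<times> C) = {})"

text \<open>A walk inside \<open>A\<close> that starts on one side of the separation can never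
  change sides.\<close>

lemma separated_not_connected:
  assumes "separated (parcs G) A" and "A \<subseteq> pverts G"
  shows "\<not> connected (remove_verts (with_proj G) (pverts G - A))"
proof
  let ?K = "remove_verts (with_proj G) (pverts G - A)"
  assume conn: "connected ?K"
  obtain C D where CD: "C \<noteq> {}" "D \<noteq> {}" "C \<inter> D = {}" "A = C \<union> D"
    "parcs G \<inter> (C \<times> D \<union> D \<times> C) = {}" using assms(1) unfolding separated_def by blast
  then obtain c d where c: "c \<in> C" and d: "d \<in> D" by blast
  have vK: "verts ?K = A" using assms(2) by (auto simp: remove_verts_def)
  have aK: "x \<in> A \<and> y \<in> A \<and> (x, y) \<in> parcs G" if "(x, y) \<in> arcs_ends ?K" for x y
    using that assms(2) by (auto simp: remove_verts_def arcs_ends_conv)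
  have "(c, d) \<in> rtrancl_on A (symcl (arcs_ends ?K))"
    using conn c d CD(4) unfolding connected_conv vK by auto
  then have "d \<in> C"
  proof (induction rule: rtrancl_on_induct)
    case base
    then show ?case using c by simp
  next
    case (step x y)
    then have "(x, y) \<in> parcs G \<or> (y, x) \<in> parcs G" "y \<in> A"
      using aK by (auto simp: symcl_def)
    then show ?case using step CD by auto
  qed
  then show False using d CD(3) by blast
qed

section \<open>Co-components of cographs\<close>

lemma cograph_nonempty: "cograph G \<Longrightarrow> pverts G \<noteq> {}"
  by (induction rule: cograph.induct) (auto simp: graph_union_def graph_join_def)

lemma cograph_arcs: "cograph G \<Longrightarrow> parcs G \<subseteq> pverts G \<times> pverts G"
  by (induction rule: cograph.induct) (auto simp: graph_union_def graph_join_def)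

text \<open>The parts are the components of the complement.\<close>

lemma cograph_co_components:
  assumes "cograph G"
  obtains P where "\<Union> P = pverts G"
    and "\<And>A x y. \<lbrakk> A \<in> P; x \<in> A; y \<in> pverts G - A \<rbrakk> \<Longrightarrow> (x, y) \<in> parcs G"
    and "\<And>A. A \<in> P \<Longrightarrow> (\<exists>v. A = {v}) \<or> separated (parcs G) A"
  using assms
proof (induction arbitrary: thesis)
  case (K1 v)
  show ?case by (rule K1[of "{{v}}"]) auto
next
  case (union G H)
  let ?J = "graph_union G H"
  \<comment> \<open>The complement of a disjoint union is connected, so the whole vertex set is a
    single part; the two operands separate it.\<close>
  have "separated (parcs ?J) (pverts ?J)"
    unfolding separated_def
    using cograph_nonempty[OF union.hyps(1)] cograph_nonempty[OF union.hyps(2)]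
      cograph_arcs[OF union.hyps(1)] cograph_arcs[OF union.hyps(2)] union.hyps(3)
    by (intro exI[of _ "pverts G"] exI[of _ "pverts H"])
      (auto simp: graph_union_def disjoint_graphs_def)
  then show ?case by (intro union.prems[of "{pverts ?J}"]) auto
next
  case (join G H)
  let ?J = "graph_join G H"
  obtain P where P: "\<Union> P = pverts G"
    "\<And>A x y. \<lbrakk> A \<in> P; x \<in> A; y \<in> pverts G - A \<rbrakk> \<Longrightarrow> (x, y) \<in> parcs G"
    "\<And>A. A \<in> P \<Longrightarrow> (\<exists>v. A = {v}) \<or> separated (parcs G) A"
    by (rule join.IH(1)) blast
  obtain Q where Q: "\<Union> Q = pverts H"
    "\<And>A x y. \<lbrakk> A \<in> Q; x \<in> A; y \<in> pverts H - A \<rbrakk> \<Longrightarrow> (x, y) \<in> parcs H"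
    "\<And>A. A \<in> Q \<Longrightarrow> (\<exists>v. A = {v}) \<or> separated (parcs H) A"
    by (rule join.IH(2)) blast
  have dis: "pverts G \<inter> pverts H = {}" using join.hyps(3) by (simp add: disjoint_graphs_def)
  \<comment> \<open>A separation concerns only edges inside the part, and a join adds none inside
    either operand. Hence the parts of both operands together serve for the join.\<close>
  have restr: "separated (parcs ?J) A" if sep: "separated E A" and AW: "A \<subseteq> W"
    and JW: "parcs ?J \<inter> W \<times> W \<subseteq> E" for E A W
  proof -
    obtain C D where CD: "C \<noteq> {}" "D \<noteq> {}" "C \<inter> D = {}" "A = C \<union> D"
      and no: "E \<inter> (C \<times> D \<union> D \<times> C) = {}"
      using sep unfolding separated_def by blast
    have "C \<times> D \<union> D \<times> C \<subseteq> W \<times> W" using CD(4) AW by blast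
    then have "parcs ?J \<inter> (C \<times> D \<union> D \<times> C) = {}" using JW no by blast
    then show ?thesis unfolding separated_def using CD by metis
  qed
  have G: "parcs ?J \<inter> pverts G \<times> pverts G \<subseteq> parcs G"
    and H: "parcs ?J \<inter> pverts H \<times> pverts H \<subseteq> parcs H"
    using dis cograph_arcs[OF join.hyps(1)] cograph_arcs[OF join.hyps(2)]
    by (auto simp: graph_join_def)
  show ?case
  proof (rule join.prems[of "P \<union> Q"])
    show "\<Union> (P \<union> Q) = pverts ?J" using P(1) Q(1) by (simp add: graph_join_def)
  next
    fix A x y
    assume "A \<in> P \<union> Q" "x \<in> A" "y \<in> pverts ?J - A"
    then show "(x, y) \<in> parcs ?J" using P(1,2) Q(1,2) by (auto simp: graph_join_def)
  next
    fix A
    assume "A \<in> P \<union> Q"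
    then show "(\<exists>v. A = {v}) \<or> separated (parcs ?J) A"
      using P(1,3) Q(1,3) restr[OF _ _ G] restr[OF _ _ H] by (metis UnE Sup_upper)
  qed
qed

section \<open>Degree bounds and the choice of the copy of the tree\<close>

lemma min_degree_le:
  fixes G :: "'a pair_pre_digraph"
  assumes "pair_graph G" and "v \<in> pverts G"
  shows "min_degree G \<le> card (parcs G `` {v})"
proof -
  interpret G: pair_graph G by fact
  have "out_arcs G v = Pair v ` (parcs G `` {v})"
    by (auto simp: out_arcs_def image_iff)
  then have "out_degree G v = card (parcs G `` {v})"
    unfolding out_degree_def by (simp add: card_image inj_on_def)
  moreover have "min_degree G \<le> out_degree G v"
    unfolding min_degree_def using assms(2) G.finite_verts by (intro Min_le) auto
  ultimately show ?thesis by simp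
qed

text \<open>All neighbours of a vertex on one side of the separation lie on the same side or in
  \<open>B\<close>, so each side has at least \<open>d + 1 - card B\<close> vertices.\<close>

lemma separated_card_ge:
  assumes "separated E A" and "finite A" and "finite B"
    and "\<And>a. a \<in> A \<Longrightarrow> E `` {a} \<subseteq> A \<union> B \<and> a \<notin> E `` {a} \<and> d \<le> card (E `` {a})"
  shows "2 * (d + 1 - card B) \<le> card A"
proof -
  obtain C D where CD: "C \<noteq> {}" "D \<noteq> {}" "C \<inter> D = {}" "A = C \<union> D"
    "E \<inter> (C \<times> D \<union> D \<times> C) = {}" using assms(1) unfolding separated_def by blast
  have side: "d + 1 \<le> card K + card B"
    if K: "K \<noteq> {}" "A = K \<union> L" "E \<inter> K \<times> L = {}" for K L
  proof -
    obtain c where c: "c \<in> K" using K(1) by blast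
    have finK: "finite K" using K(2) assms(2) by auto
    have c': "E `` {c} \<subseteq> A \<union> B" "c \<notin> E `` {c}" "d \<le> card (E `` {c})"
      using assms(4)[of c] c K(2) by auto
    have "E `` {c} \<subseteq> (K - {c}) \<union> B" using c' c K by auto
    then have "card (E `` {c}) \<le> card ((K - {c}) \<union> B)"
      using finK assms(3) by (intro card_mono) auto
    also have "\<dots> \<le> card (K - {c}) + card B" by (rule card_Un_le)
    finally have "d \<le> card (K - {c}) + card B" using c'(3) by linarith
    moreover have "card K = card (K - {c}) + 1" using card.remove[OF finK c] by simp
    ultimately show ?thesis by linarith
  qed
  have "d + 1 \<le> card C + card B" using side[of C D] CD by blast
  moreover have "d + 1 \<le> card D + card B" using side[of D C] CD by blast
  moreover have "card A = card C + card D"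
    using CD(3,4) assms(2) by (simp add: card_Un_disjoint)
  ultimately show ?thesis by linarith
qed

theorem corollary2:
  fixes k m :: nat
    and T :: "'b pair_pre_digraph"
    and G :: "'a pair_pre_digraph"
  assumes "k \<ge> 1" and "m \<ge> 1"
    and "undirected_tree T" and "card (pverts T) = m"
    and "pair_graph G" and "cograph G" and "k_connected k G"
    and "min_degree G \<ge> (3 * k) div 2 + m - 1"
  shows "\<exists>T' :: 'a pair_pre_digraph. undirected_tree T' \<and> subgraph T' G \<and> digraph_iso T' T \<and>
           k_connected k (remove_verts G (pverts T'))"
proof -
  interpret T: pair_graph T using assms(3) by (simp add: undirected_tree_def)
  interpret G: pair_graph G by fact
  let ?V = "pverts G" and ?D = "parcs G" and ?U = "pverts T" and ?E = "parcs T"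
  have finV: "finite ?V" using G.finite_verts by simp
  have D: "sym ?D" "irrefl ?D"
    using G.arcs_symmetric G.no_loops' by (auto simp: irrefl_def intro: symI)
  have E: "sym ?E" "irrefl ?E"
    using T.arcs_symmetric T.no_loops' by (auto simp: irrefl_def intro: symI)
  have F: "forest_on ?E ?U" using assms(3) by (rule undirected_tree_forest_on)
  have finU: "finite ?U" using F by (rule forest_on_finite)
  have nbV: "?D `` {v} \<subseteq> ?V" for v using G.in_arcsD2 by auto
  have deg: "(3 * k) div 2 + m - 1 \<le> card (?D `` {v})" if "v \<in> ?V" for v
    using min_degree_le[OF assms(5) that] assms(8) by linarith
  obtain v0 where v0: "v0 \<in> ?V" using cograph_nonempty[OF assms(6)] by blast
  have "?D `` {v0} \<subset> ?V" using nbV v0 D(2) by (auto simp: irrefl_def)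
  then have "card (?D `` {v0}) < card ?V" by (rule psubset_card_mono[OF finV])
  then have cardV: "(3 * k) div 2 + m \<le> card ?V" using deg[OF v0] by linarith
  have suff: ?thesis if emb: "embedding ?E ?U ?D ?V f"
    and conn: "k_connected k (remove_verts G (?V \<inter> f ` ?U))" for f
  proof -
    obtain T' where T': "undirected_tree T'" "subgraph (with_proj T') (with_proj G)"
      "digraph_iso (with_proj T') (with_proj T)" "pverts T' = f ` ?U"
      using undirected_tree_image[OF assms(3,5) emb] by blast
    have "?V \<inter> f ` ?U = f ` ?U" using emb by (auto simp: embedding_def)
    then show ?thesis using T' conn by (intro exI[of _ T']) simp
  qed
  obtain P where P: "\<Union> P = ?V"
    "\<And>A x y. \<lbrakk> A \<in> P; x \<in> A; y \<in> ?V - A \<rbrakk> \<Longrightarrow> (x, y) \<in> ?D"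
    "\<And>A. A \<in> P \<Longrightarrow> (\<exists>v. A = {v}) \<or> separated ?D A"
    by (rule cograph_co_components[OF assms(6)]) blast
  show ?thesis
  \<comment> \<open>In the second alternative \<open>k\<close> vertices survive outside every
    co-component, whichever \<open>m\<close> vertices are deleted. The order \<open>m + 1\<close> is
    set apart because the single surviving vertex is covered by the convention for
    \<open>K_1\<close>, not by counting.\<close>
  proof (cases "card ?V = m + 1 \<or> (\<forall>A\<in>P. k + m \<le> card (?V - A))")
    case True
    have "\<exists>f. embedding ?E ?U ?D ?V f"
    proof (rule forest_on_embedding[OF F E D finV])
      show "card ?U \<le> card ?V" using cardV assms(4) by simp
      show "card ?U \<le> card (?D `` {a} \<inter> ?V) + 1" if "a \<in> ?V" for a
        using deg[OF that] nbV[of a] assms(1,4) by (simp add: Int_absorb2)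
    qed
    then obtain f where f: "embedding ?E ?U ?D ?V f" by blast
    have img: "f ` ?U \<subseteq> ?V" "card (f ` ?U) = m"
      using f assms(4) by (auto simp: embedding_def card_image)
    show ?thesis
    proof (rule suff[OF f], cases "card ?V = m + 1")
      case True
      \<comment> \<open>The order bound gives \<open>(3 * k) div 2 \<le> 1\<close>.\<close>
      then have k1: "k = 1" using cardV assms(1) by linarith
      have "card (?V - f ` ?U) = 1"
        using True img finU by (simp add: card_Diff_subset)
      moreover have "?V - f ` ?U \<noteq> {}" using calculation by fastforce
      moreover have "?V - ?V \<inter> f ` ?U = ?V - f ` ?U" by blast
      ultimately show "k_connected k (remove_verts G (?V \<inter> f ` ?U))"
        using k1 by (simp add: k_connected_def remove_verts_def)
    next
      case False
      have large: "k + m \<le> card (?V - A)" if "A \<in> P" for A using True False that by blast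
      show "k_connected k (remove_verts G (?V \<inter> f ` ?U))"
      proof (rule k_connected_remove_vertsI[OF assms(5,1)])
        have "m < card ?V" using cardV assms(1) by linarith
        then have "\<not> ?V \<subseteq> f ` ?U" using img finU by (metis card_mono finite_imageI not_less)
        then show "?V - ?V \<inter> f ` ?U \<noteq> {}" by blast
      next
        fix a
        assume "a \<in> ?V - ?V \<inter> f ` ?U"
        then obtain A where A: "A \<in> P" "a \<in> A" using P(1) by blast
        have "card (?V - A) - card (f ` ?U) \<le> card (?V - A - f ` ?U)"
          using finU by (intro diff_card_le_card_Diff) simp
        moreover have "?V - ?V \<inter> f ` ?U - A = ?V - A - f ` ?U" by blast
        ultimately have "k \<le> card (?V - ?V \<inter> f ` ?U - A)"
          using large[OF A(1)] img(2) by simp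
        then show "\<exists>A. a \<in> A \<and> k \<le> card (?V - ?V \<inter> f ` ?U - A) \<and>
            (\<forall>x\<in>A \<inter> ?V. \<forall>y\<in>?V - A. (x, y) \<in> ?D)"
          using A P(2) by blast
      qed
    qed
  next
    case False
    then obtain A where A: "A \<in> P" "card (?V - A) < k + m" and n: "card ?V \<noteq> m + 1"
      by (auto simp: not_le)
    let ?B = "?V - A"
    have AV: "A \<subseteq> ?V" using A(1) P(1) by blast
    have finA: "finite A" and finB: "finite ?B"
      using finite_subset[OF AV finV] finV by auto
    have cAB: "card A + card ?B = card ?V"
      using card_Diff_subset[OF finA AV] card_mono[OF finV AV] by linarith
    \<comment> \<open>A singleton would give \<open>card ?V \<le> k + m\<close>. As
      \<open>(3 * k) div 2 + m \<le> card ?V\<close>, this forces \<open>k = 1\<close> and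
      \<open>card ?V = m + 1\<close>, the case already treated.\<close>
    have "\<nexists>v. A = {v}"
    proof
      assume "\<exists>v. A = {v}"
      then have "card A = 1" by auto
      then show False using cAB A(2) cardV n assms(1) by linarith
    qed
    then have sep: "separated ?D A" using P(3)[OF A(1)] by blast
    \<comment> \<open>Deleting \<open>?B\<close> leaves the disconnected graph on \<open>A\<close>,
      so \<open>?B\<close> is a vertex cut.\<close>
    have kB: "k \<le> card ?B"
    proof (rule k_connected_card_le[OF assms(7)])
      show "?B \<subset> verts (with_proj G)" using sep AV by (auto simp: separated_def)
      show "\<not> connected (remove_verts (with_proj G) ?B) \<or>
          card (verts (remove_verts (with_proj G) ?B)) = 1"
        using separated_not_connected[OF sep AV] by blast
      show "card (verts (with_proj G)) \<noteq> 1" using cardV assms(1,2) by auto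
    qed
    have cA: "2 * ((3 * k) div 2 + m - 1 + 1 - card ?B) \<le> card A"
      by (rule separated_card_ge[OF sep finA finB])
        (use deg nbV AV D(2) in \<open>auto simp: irrefl_def\<close>)
    have "\<exists>f. embedding ?E ?U ?D (A \<union> ?B) f \<and> k \<le> card (A - f ` ?U) \<and> k \<le> card (?B - f ` ?U)"
    proof (rule embedding_join_forest[OF F E D finA finB])
      show "A \<inter> ?B = {}" by blast
      show "A \<times> ?B \<subseteq> ?D" using P(2)[OF A(1)] by auto
      show "k \<le> card ?B" by (rule kB)
      \<comment> \<open>With \<open>card ?B \<le> k + m - 1\<close>, the bound \<open>cA\<close>
        yields \<open>card A \<ge> 2 * (k div 2) + 2 > k\<close>. Adding \<open>card ?B\<close> to
        \<open>cA\<close> yields a sum of at least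
        \<open>2 * ((3 * k) div 2) + 2 * m - card ?B\<close>, and
        \<open>2 * ((3 * k) div 2) \<ge> 3 * k - 1\<close> turns this into \<open>2 * k + m\<close>,
        as the next goal asks.\<close>
      show "k \<le> card A" using cA A(2) by linarith
      show "2 * k + card ?U \<le> card A + card ?B" using cA A(2) kB assms(4) by linarith
    next
      fix a
      assume "a \<in> A \<union> ?B"
      then have "a \<in> ?V" using AV by blast
      moreover have "A \<union> ?B = ?V" using AV by blast
      ultimately show "k + card ?U \<le> card (?D `` {a} \<inter> (A \<union> ?B)) + 1"
        using deg[of a] nbV[of a] assms(1,4) by (simp add: Int_absorb2)
    qed
    moreover have AB: "A \<union> ?B = ?V" using AV by blast
    ultimately obtain f where f: "embedding ?E ?U ?D ?V f"
      "k \<le> card (A - f ` ?U)" "k \<le> card (?B - f ` ?U)" by auto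
    show ?thesis
    proof (rule suff[OF f(1)], rule k_connected_remove_vertsI[OF assms(5,1)])
      have "A - f ` ?U \<noteq> {}" using f(2) assms(1) by fastforce
      then show "?V - ?V \<inter> f ` ?U \<noteq> {}" using AV by blast
    next
      fix a
      assume "a \<in> ?V - ?V \<inter> f ` ?U"
      \<comment> \<open>The coarse partition into \<open>A\<close> and \<open>?B\<close> suffices
        here: each part keeps \<open>k\<close> vertices, which lie outside the other one.\<close>
      then consider "a \<in> A" | "a \<in> ?B" by blast
      then show "\<exists>A. a \<in> A \<and> k \<le> card (?V - ?V \<inter> f ` ?U - A) \<and>
          (\<forall>x\<in>A \<inter> ?V. \<forall>y\<in>?V - A. (x, y) \<in> ?D)"
      proof cases
        case 1
        have "?V - ?V \<inter> f ` ?U - A = ?B - f ` ?U" by blast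
        then show ?thesis using 1 f(3) P(2)[OF A(1)] by (intro exI[of _ A]) auto
      next
        case 2
        have "?V - ?V \<inter> f ` ?U - ?B = A - f ` ?U" using AV by blast
        moreover have "(x, y) \<in> ?D" if "x \<in> ?B" "y \<in> ?V - ?B" for x y
          using P(2)[OF A(1), of y x] that G.arcs_symmetric by blast
        ultimately show ?thesis using 2 f(2) by (intro exI[of _ ?B]) auto
      qed
    qed
  qed
qed

end
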